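(* Let $s\mapsto\gamma(s)=(x(s),y(s),z(s),R(s))$ be a sub-Riemannian geodesic in $(SE(3),\Delta,\mathcal G_1)$ with $\lambda_6=0$ and $\lambda_1^2(0)+\lambda_2^2(0)+\lambda_3^2(0)\ne0$, departing from $e=(\mathbf 0,I)$, such that the spatial projection is cuspless. If $\underline\lambda^{(1)}(0)\cdot\underline\lambda^{(2)}(0)\ge0$, then $z(s)>0$ for all $s\in(0,s_{max})$. If $\underline\lambda^{(1)}(0)\cdot\underline\lambda^{(2)}(0)<0$, then $z(s)>0$ for all $s\in(0,s_m)$, with $$s_m=\begin{cases}\log\frac{|\lambda_4(0)+\lambda_5(0)|}{|\lambda_4(0)-\lambda_5(0)|},&\text{if }\underline\lambda^{(1)}(0)=-\underline\lambda^{(2)}(0),\\[4pt]\log\frac{\|\underline\lambda^{(2)}(0)-\underline\lambda^{(1)}(0)\|}{\|\underline\lambda^{(2)}(0)+\underline\lambda^{(1)}(0)\|},&\text{otherwise.}\end{cases}$$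
   Context: $SE(3)=\mathbb R^3\rtimes SO(3)$; $\Delta=\mathrm{span}\{\mathcal A_3,\mathcal A_4,\mathcal A_5\}$ with $\mathcal A_3,\mathcal A_4,\mathcal A_5$ the left-invariant vector fields generating translation along the $z$-axis and rotations about the $x$- and $y$-axis, which are orthonormal for $\mathcal G_1$. Geodesics from $e$ with $\lambda_6=0$ (normalized $\lambda_3^2+\lambda_4^2+\lambda_5^2=1$) and cuspless spatial projection $\mathbf x=(x,y,z)$ are described in spatial arclength $s$ as follows. The momentum is $\lambda_1(s)=\lambda_1(0)\cosh s-\lambda_5(0)\sinh s$, $\lambda_5(s)=\lambda_5(0)\cosh s-\lambda_1(0)\sinh s$, $\lambda_2(s)=\lambda_2(0)\cosh s+\lambda_4(0)\sinh s$, $\lambda_4(s)=\lambda_4(0)\cosh s+\lambda_2(0)\sinh s$, $\lambda_3(s)=\sqrt{1-\lambda_4(s)^2-\lambda_5(s)^2}$, with $\lambda_4(0)^2+\lambda_5(0)^2\le1$; $s_{max}\in(0,\infty]$ is the minimal $s>0$ with $\lambda_3(s)=0$; $\gamma(0)=(\mathbf 0,I)$ and for $0<s<s_{max}$ $$\mathbf x'(s)=R(s)\mathbf e_z,\qquad R'(s)=\frac1{\lambda_3(s)}R(s)\begin{pmatrix}0&0&\lambda_5(s)\\0&0&-\lambda_4(s)\\-\lambda_5(s)&\lambda_4(s)&0\end{pmatrix}.$$ Notation: $\underline\lambda^{(1)}=(-\lambda_1,-\lambda_2)$, $\underline\lambda^{(2)}=(\lambda_5,-\lambda_4)$. Logarithms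 are taken in $[-\infty,\infty]$ (with $\log0=-\infty$, $\log(a/0)=+\infty$ for $a>0$), and $(0,s_m)=\emptyset$ if $s_m\le0$. *)

theory Defs
  imports "HOL-Analysis.Analysis"
begin

text \<open>A point of SE(3) is a pair \<open>(x, R)\<close> of a position and a rotation matrix.\<close>

definition SE3 :: "((real^3) \<times> (real^3^3)) set" where
  "SE3 = {(x, R). orthogonal_matrix R \<and> det R = 1}"

definition z_coord :: "(real^3) \<times> (real^3^3) \<Rightarrow> real" where
  "z_coord g = fst g $ 3"

text \<open>
  The momentum covector along a geodesic, as a function of spatial arclength, with
  \<open>\<lambda>\<^sub>i(s) = lam s $ i\<close>.  The real square root of the library is the odd extension
  (\<open>sqrt (- a) = - sqrt a\<close>), so \<open>lam s $ 3\<close> is positive or zero exactly when the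
  radicand is.
\<close>

definition geodesic_momentum :: "(real \<Rightarrow> real^6) \<Rightarrow> bool" where
  "geodesic_momentum lam \<longleftrightarrow>
     (lam 0 $ 4)\<^sup>2 + (lam 0 $ 5)\<^sup>2 \<le> 1 \<and>
     (\<forall>s. lam s $ 1 = lam 0 $ 1 * cosh s - lam 0 $ 5 * sinh s \<and>
          lam s $ 2 = lam 0 $ 2 * cosh s + lam 0 $ 4 * sinh s \<and>
          lam s $ 3 = sqrt (1 - (lam s $ 4)\<^sup>2 - (lam s $ 5)\<^sup>2) \<and>
          lam s $ 4 = lam 0 $ 4 * cosh s + lam 0 $ 2 * sinh s \<and>
          lam s $ 5 = lam 0 $ 5 * cosh s - lam 0 $ 1 * sinh s \<and>
          lam s $ 6 = 0)"

text \<open>The first positive zero of \<open>\<lambda>\<^sub>3\<close>; it is \<open>\<infinity>\<close> if there is none (infimum of the empty set).\<close>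

definition s_max :: "(real \<Rightarrow> real^6) \<Rightarrow> ereal" where
  "s_max lam = Inf {ereal s | s. s > 0 \<and> lam s $ 3 = 0}"

definition rotation_generator :: "real^6 \<Rightarrow> real^3^3" where
  "rotation_generator l = vector
     [vector [0,       0,     l $ 5],
      vector [0,       0,     - l $ 4],
      vector [- l $ 5, l $ 4, 0]]"

text \<open>
  The sub-Riemannian geodesics starting at the identity with \<open>\<lambda>\<^sub>6 = 0\<close>, parametrised by
  spatial arclength on \<open>[0, s_max)\<close>.  The derivative may blow up at \<open>s = 0\<close> when
  \<open>\<lambda>\<^sub>3(0) = 0\<close>, so the equations are imposed for \<open>s > 0\<close> only and the initial condition
  is linked to them by continuity.
\<close>

definition geodesic_from_identity ::
    "(real \<Rightarrow> real^6) \<Rightarrow> (real \<Rightarrow> (real^3) \<times> (real^3^3)) \<Rightarrow> bool" where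
  "geodesic_from_identity lam \<gamma> \<longleftrightarrow>
     geodesic_momentum lam \<and>
     \<gamma> 0 = (0, mat 1) \<and>
     (\<forall>s. 0 \<le> s \<and> ereal s < s_max lam \<longrightarrow> \<gamma> s \<in> SE3) \<and>
     continuous_on {s. 0 \<le> s \<and> ereal s < s_max lam} \<gamma> \<and>
     (\<forall>s. 0 < s \<and> ereal s < s_max lam \<longrightarrow>
        ((\<lambda>t. fst (\<gamma> t)) has_vector_derivative (snd (\<gamma> s) *v axis 3 1)) (at s) \<and>
        ((\<lambda>t. snd (\<gamma> t)) has_vector_derivative
           ((1 / lam s $ 3) *\<^sub>R (snd (\<gamma> s) ** rotation_generator (lam s)))) (at s))"

text \<open>
  The speed of the spatial projection with respect to sub-Riemannian arclength is \<open>\<lambda>\<^sub>3\<close>, so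
  absence of cusps means positivity of \<open>\<lambda>\<^sub>3\<close>.  If \<open>\<lambda>\<^sub>3(0) > 0\<close> this holds automatically up to
  \<open>s_max\<close>; the condition rules out initial momenta for which \<open>1 - \<lambda>\<^sub>4\<^sup>2 - \<lambda>\<^sub>5\<^sup>2\<close> vanishes at \<open>0\<close>
  and is negative immediately afterwards, where no geodesic exists.
\<close>

definition cuspless :: "(real \<Rightarrow> real^6) \<Rightarrow> bool" where
  "cuspless lam \<longleftrightarrow> (\<forall>s. 0 < s \<and> ereal s < s_max lam \<longrightarrow> lam s $ 3 > 0)"

definition lambda_fst :: "real^6 \<Rightarrow> real^2" where
  "lambda_fst l = vector [- l $ 1, - l $ 2]"

definition lambda_snd :: "real^6 \<Rightarrow> real^2" where
  "lambda_snd l = vector [l $ 5, - l $ 4]"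

text \<open>
  \<open>log (a / b)\<close> in the extended reals for \<open>a, b \<ge> 0\<close> not both zero.  (The case \<open>a = b = 0\<close>
  does not occur in \<open>s_m\<close> when \<open>lambda_fst l \<bullet> lambda_snd l < 0\<close>.)
\<close>

definition log_quotient :: "real \<Rightarrow> real \<Rightarrow> ereal" where
  "log_quotient a b = (if a = 0 then - \<infinity> else if b = 0 then \<infinity> else ereal (ln (a / b)))"

definition s_m :: "real^6 \<Rightarrow> ereal" where
  "s_m l =
     (if lambda_fst l = - lambda_snd l
      then log_quotient \<bar>l $ 4 + l $ 5\<bar> \<bar>l $ 4 - l $ 5\<bar>
      else log_quotient (norm (lambda_snd l - lambda_fst l)) (norm (lambda_snd l + lambda_fst l)))"

end

theory Submission
  imports Defs
begin

text \<open>
  With \<open>V(s) = lambda_snd (lam s)\<close> one has \<open>V(s) = e\<^sup>s p + e\<^sup>-\<^sup>s q\<close>, and the unit tangent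
  \<open>T = R e\<^sub>z\<close> moves on the sphere with speed \<open>\<parallel>V\<parallel> / \<lambda>\<^sub>3 = \<parallel>V\<parallel> / sqrt (1 - \<parallel>V\<parallel>\<^sup>2)\<close>.  Since
  \<open>\<parallel>V\<parallel> \<le> \<parallel>p\<parallel> e\<^sup>s + \<parallel>q\<parallel> e\<^sup>-\<^sup>s\<close>, this speed is at most the derivative of \<open>arcsin S\<close>, where \<open>S\<close> is
  \<open>\<parallel>p\<parallel> e\<^sup>s - \<parallel>q\<parallel> e\<^sup>-\<^sup>s\<close> normalised so that \<open>1 - S\<^sup>2\<close> is proportional to \<open>1 - \<parallel>V\<parallel>\<^sup>2\<close>.  Hence
  \<open>z'(s) = T(0) \<bullet> T(s) \<ge> cos (arcsin S(s) - arcsin S(0))\<close>.  The sign of \<open>\<parallel>p\<parallel> - \<parallel>q\<parallel>\<close>, that is of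
  \<open>S(0)\<close>, is the sign of the inner product in the statement.  If it is nonnegative, the angle stays
  in \<open>[0, \<pi>/2)\<close> and \<open>z' > 0\<close>.  Otherwise \<open>z' \<ge> S(0) S(s)\<close>, whose integral is explicit and
  positive as long as \<open>\<parallel>p\<parallel> e\<^sup>s < \<parallel>q\<parallel>\<close>, i.e. up to \<open>log (\<parallel>q\<parallel> / \<parallel>p\<parallel>)\<close>.
\<close>

section \<open>Angle comparison for curves on the unit sphere\<close>

text \<open>Where \<open>\<bar>n s\<bar> < 1\<close>, the inequality \<open>bound\<close> says that
  \<open>arccos n\<close> grows no faster than \<open>\<psi>\<close>.\<close>

lemma arccos_comparison:
  fixes n \<psi> :: "real \<Rightarrow> real"
  assumes ab: "a \<le> b"
    and n_cont: "continuous_on {a..b} n" and \<psi>_cont: "continuous_on {a..b} \<psi>"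
    and n_deriv: "\<And>s. a < s \<Longrightarrow> s < b \<Longrightarrow> (n has_real_derivative n' s) (at s)"
    and \<psi>_deriv: "\<And>s. a < s \<Longrightarrow> s < b \<Longrightarrow> (\<psi> has_real_derivative \<psi>' s) (at s)"
    and bound: "\<And>s. a < s \<Longrightarrow> s < b \<Longrightarrow> - n' s \<le> \<psi>' s * sqrt (1 - (n s)\<^sup>2)"
    and \<psi>_mono: "\<And>s. a \<le> s \<Longrightarrow> s \<le> b \<Longrightarrow> \<psi> a \<le> \<psi> s"
    and \<psi>_less_pi: "\<And>s. a \<le> s \<Longrightarrow> s \<le> b \<Longrightarrow> \<psi> s - \<psi> a < pi"
    and n_range: "\<And>s. a \<le> s \<Longrightarrow> s \<le> b \<Longrightarrow> \<bar>n s\<bar> \<le> 1"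
    and start: "n a = 1"
  shows "cos (\<psi> b - \<psi> a) \<le> n b"
proof (rule ccontr)
  \<comment> \<open>\<open>arccos\<close> is not differentiable at \<open>\<plusminus>1\<close>, so the argument is run just after the last point \<open>c\<close>
    at which the inequality holds, where \<open>-1 < n < 1\<close>.\<close>
  assume "\<not> cos (\<psi> b - \<psi> a) \<le> n b"
  then have neg: "n b - cos (\<psi> b - \<psi> a) < 0" by simp
  define d where "d s = n s - cos (\<psi> s - \<psi> a)" for s
  have d_cont: "continuous_on {a..b} d"
    unfolding d_def by (intro continuous_intros n_cont \<psi>_cont)
  have "compact ({a..b} \<inter> d -` {0..})"
    using continuous_closed_preimage[OF d_cont] bounded_Int[of "{a..b}"]
    by (simp add: compact_eq_bounded_closed)
  moreover have "{a..b} \<inter> d -` {0..} \<noteq> {}"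
    using ab start by (auto simp: d_def intro!: exI[of _ a])
  ultimately obtain c where c: "c \<in> {a..b} \<inter> d -` {0..}"
    and c_max: "\<And>s. s \<in> {a..b} \<inter> d -` {0..} \<Longrightarrow> s \<le> c"
    using compact_attains_sup[of "{a..b} \<inter> d -` {0..}"] by blast
  have cb: "c < b"
    using c neg by (cases "c = b") (auto simp: d_def)
  have below: "n s < cos (\<psi> s - \<psi> a)" if "c < s" "s \<le> b" for s
    using c_max[of s] c that by (force simp: d_def)
  \<comment> \<open>An angle below \<open>pi\<close> keeps \<open>n c\<close> off -1, and continuity
    extends this to the right of \<open>c\<close>.\<close>
  have "cos (\<psi> c - \<psi> a) > cos pi"
    using \<psi>_mono[of c] \<psi>_less_pi[of c] c cb by (intro cos_monotone_0_pi) auto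
  then have nc: "n c > -1" using c by (simp add: d_def)
  have "continuous_on {c..b} n" using n_cont c by (auto intro: continuous_on_subset)
  from order_tendstoD(1)[OF continuous_on_Icc_at_rightD[OF this cb] nc]
  have "eventually (\<lambda>s. n s > -1) (at_right c)" .
  then obtain e where e: "e > c" "\<And>s. c < s \<Longrightarrow> s < e \<Longrightarrow> n s > -1"
    unfolding eventually_at_right_field by blast
  define m where "m = min b ((c + e) / 2)"
  have m: "c < m" "m \<le> b" "m < e" using e cb by (auto simp: m_def min_def field_simps)
  define h where "h s = arccos (n s) - \<psi> s" for s
  have "h m \<le> h c"
  proof (rule DERIV_nonpos_imp_decreasing_open[where f = h])
    show "c \<le> m" using m by simp
    show "continuous_on {c..m} h" unfolding h_def
      using c m n_range n_cont \<psi>_cont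
      by (intro continuous_intros continuous_on_subset[OF n_cont] continuous_on_subset[OF \<psi>_cont])
         (force simp: abs_le_iff)+
    fix s assume s: "c < s" "s < m"
    have as: "a < s" "s < b" using s c m by auto
    have n1: "n s < 1" using below[of s] s m cos_le_one[of "\<psi> s - \<psi> a"] by linarith
    have n2: "-1 < n s" using e(2)[of s] s m by auto
    have r: "sqrt (1 - (n s)\<^sup>2) > 0" using n1 n2 by (simp add: abs_square_less_1 abs_less_iff)
    have "(h has_real_derivative inverse (- sqrt (1 - (n s)\<^sup>2)) * n' s - \<psi>' s) (at s)"
      unfolding h_def
      by (intro derivative_intros \<psi>_deriv as
            DERIV_chain2[where f = arccos, OF DERIV_arccos n_deriv[OF as]] n1 n2)
    moreover have "inverse (- sqrt (1 - (n s)\<^sup>2)) * n' s - \<psi>' s \<le> 0"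
      using bound[OF as] r by (simp add: field_simps)
    ultimately show "\<exists>y. (h has_real_derivative y) (at s) \<and> y \<le> 0" by blast
  qed
  \<comment> \<open>\<open>h m \<le> h c\<close> clashes with the choice of \<open>c\<close>:
    \<open>arccos n\<close> is at most \<open>\<psi> - \<psi> a\<close> at \<open>c\<close> but
    exceeds it at \<open>m\<close>.\<close>
  moreover have "arccos (n c) \<le> arccos (cos (\<psi> c - \<psi> a))"
    using c n_range[of c] by (intro arccos_le_arccos) (auto simp: d_def)
  moreover have "arccos (cos (\<psi> m - \<psi> a)) < arccos (n m)"
    using below[of m] m n_range[of m] c by (intro arccos_less_arccos) (auto simp: abs_le_iff)
  moreover have "arccos (cos (\<psi> c - \<psi> a)) = \<psi> c - \<psi> a"
      "arccos (cos (\<psi> m - \<psi> a)) = \<psi> m - \<psi> a"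
    using \<psi>_mono[of c] \<psi>_less_pi[of c] \<psi>_mono[of m] \<psi>_less_pi[of m] c m
    by (auto intro!: arccos_cos)
  ultimately show False by (simp add: h_def)
qed

text \<open>The angle between \<open>T a\<close> and \<open>T s\<close> grows no faster than the
  arclength of \<open>T\<close>, whose growth \<open>\<psi>\<close> dominates.\<close>

lemma cos_le_inner_unit_curve:
  fixes T :: "real \<Rightarrow> 'a::real_inner" and \<psi> :: "real \<Rightarrow> real"
  assumes ab: "a \<le> b"
    and T_cont: "continuous_on {a..b} T" and \<psi>_cont: "continuous_on {a..b} \<psi>"
    and T_unit: "\<And>s. a \<le> s \<Longrightarrow> s \<le> b \<Longrightarrow> norm (T s) = 1"
    and T_deriv: "\<And>s. a < s \<Longrightarrow> s < b \<Longrightarrow> (T has_vector_derivative T' s) (at s)"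
    and \<psi>_deriv: "\<And>s. a < s \<Longrightarrow> s < b \<Longrightarrow> (\<psi> has_real_derivative \<psi>' s) (at s)"
    and speed: "\<And>s. a < s \<Longrightarrow> s < b \<Longrightarrow> norm (T' s) \<le> \<psi>' s"
    and \<psi>_less_pi: "\<And>s. a \<le> s \<Longrightarrow> s \<le> b \<Longrightarrow> \<psi> s - \<psi> a < pi"
  shows "cos (\<psi> b - \<psi> a) \<le> T a \<bullet> T b"
proof (rule arccos_comparison[where n = "\<lambda>s. T a \<bullet> T s" and n' = "\<lambda>s. T a \<bullet> T' s" and \<psi>' = \<psi>'])
  show "continuous_on {a..b} (\<lambda>s. T a \<bullet> T s)"
    by (intro continuous_intros T_cont)
  show "\<bar>T a \<bullet> T s\<bar> \<le> 1" if "a \<le> s" "s \<le> b" for s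
    using Cauchy_Schwarz_ineq2[of "T a" "T s"] T_unit that ab by auto
  show "T a \<bullet> T a = 1" using T_unit[of a] ab by (simp add: norm_eq_1)
  show "\<psi> a \<le> \<psi> s" if s: "a \<le> s" "s \<le> b" for s
  proof (rule DERIV_nonneg_imp_increasing_open[OF s(1)])
    show "continuous_on {a..s} \<psi>" using \<psi>_cont s by (auto intro: continuous_on_subset)
    show "\<exists>y. (\<psi> has_real_derivative y) (at x) \<and> 0 \<le> y" if "a < x" "x < s" for x
      by (rule exI[of _ "\<psi>' x"])
        (use \<psi>_deriv[of x] speed[of x] order_trans[OF norm_ge_zero] that s in auto)
  qed
  fix s assume s: "a < s" "s < b"
  show "((\<lambda>s. T a \<bullet> T s) has_real_derivative T a \<bullet> T' s) (at s)"
    using bounded_linear.has_vector_derivative[OF bounded_linear_inner_right T_deriv[OF s]]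
    by (simp add: has_real_derivative_iff_has_vector_derivative)
  have "((\<lambda>s. T s \<bullet> T s) has_derivative (\<lambda>h. T s \<bullet> (h *\<^sub>R T' s) + (h *\<^sub>R T' s) \<bullet> T s)) (at s)"
    using T_deriv[OF s] unfolding has_vector_derivative_def by (intro derivative_intros)
  moreover have "((\<lambda>s. T s \<bullet> T s) has_derivative (\<lambda>h. 0)) (at s)"
  proof (rule has_derivative_transform_within_open[of "\<lambda>_. 1" _ _ _ "{a<..<b}"])
    show "1 = T x \<bullet> T x" if "x \<in> {a<..<b}" for x
      using T_unit[of x] that by (simp add: norm_eq_1)
  qed (use s in auto)
  ultimately have "(\<lambda>h. T s \<bullet> (h *\<^sub>R T' s) + (h *\<^sub>R T' s) \<bullet> T s) = (\<lambda>h. 0)"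
    by (rule has_derivative_unique)
  from fun_cong[OF this, of 1] have orth: "T s \<bullet> T' s = 0"
    by (simp add: inner_commute)
  have unit: "T a \<bullet> T a = 1" "T s \<bullet> T s = 1"
    using T_unit[of a] T_unit[of s] s by (auto simp: norm_eq_1)
  \<comment> \<open>As \<open>T' s\<close> is orthogonal to \<open>T s\<close>, only the part
    \<open>r\<close> of \<open>T a\<close> orthogonal to \<open>T s\<close> contributes to the
    derivative; its norm is the square root required by the comparison.\<close>
  define r where "r = T a - (T a \<bullet> T s) *\<^sub>R T s"
  have "r \<bullet> r = 1 - (T a \<bullet> T s)\<^sup>2"
    unfolding r_def using unit
    by (simp add: inner_diff_left inner_diff_right inner_commute power2_eq_square)
  then have "norm r = sqrt (1 - (T a \<bullet> T s)\<^sup>2)" by (simp add: norm_eq_sqrt_inner)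
  moreover have "- (T a \<bullet> T' s) = - (r \<bullet> T' s)"
    unfolding r_def using orth by (simp add: inner_diff_left)
  moreover have "- (r \<bullet> T' s) \<le> norm r * norm (T' s)"
    using Cauchy_Schwarz_ineq2[of r "T' s"] by linarith
  moreover have "norm r * norm (T' s) \<le> norm r * \<psi>' s"
    using speed[OF s] by (simp add: mult_left_mono)
  ultimately show "- (T a \<bullet> T' s) \<le> \<psi>' s * sqrt (1 - (T a \<bullet> T s)\<^sup>2)"
    by (simp add: mult.commute)
qed (use ab \<psi>_cont \<psi>_deriv \<psi>_less_pi in auto)

section \<open>Normalised norm of an exponential combination\<close>

text \<open>
  The denominator of \<open>turning\<close> is \<open>sqrt (1 - b)\<close> for \<open>b\<close> the value of
  \<open>\<parallel>e\<^sup>s p + e\<^sup>-\<^sup>s q\<parallel>\<^sup>2\<close> where \<open>\<parallel>p\<parallel> e\<^sup>s = \<parallel>q\<parallel> e\<^sup>-\<^sup>s\<close>, its minimum over \<open>s\<close>.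
\<close>

definition turning :: "'a::real_inner \<Rightarrow> 'a \<Rightarrow> real \<Rightarrow> real" where
  "turning p q s =
     (norm p * exp s - norm q * exp (- s)) / sqrt (1 - 2 * (norm p * norm q + p \<bullet> q))"

text \<open>Completing the square: as \<open>exp s * exp (- s) = 1\<close>, the mixed terms are
  constant, so all dependence on \<open>s\<close> sits in one square.\<close>

lemma norm_exp_combination_sq:
  fixes p q :: "'a::real_inner"
  shows "(norm (exp s *\<^sub>R p + exp (- s) *\<^sub>R q))\<^sup>2 =
    (norm p * exp s - norm q * exp (- s))\<^sup>2 + 2 * (norm p * norm q + p \<bullet> q)"
proof -
  have e: "exp s * exp (- s) = 1" by (simp add: exp_minus_inverse)
  have "(norm (exp s *\<^sub>R p + exp (- s) *\<^sub>R q))\<^sup>2 =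
      (exp s)\<^sup>2 * (norm p)\<^sup>2 + (exp (- s))\<^sup>2 * (norm q)\<^sup>2 + 2 * (exp s * exp (- s)) * (p \<bullet> q)"
    unfolding power2_norm_eq_inner
    by (simp add: inner_add_left inner_add_right inner_commute power2_eq_square algebra_simps)
  also have "\<dots> = (norm p * exp s - norm q * exp (- s))\<^sup>2 + 2 * (exp s * exp (- s)) * (norm p * norm q)
      + 2 * (exp s * exp (- s)) * (p \<bullet> q)"
    by (simp add: power2_eq_square algebra_simps)
  finally show ?thesis by (simp add: e algebra_simps)
qed

lemma one_minus_turning_sq:
  fixes p q :: "'a::real_inner"
  assumes "2 * (norm p * norm q + p \<bullet> q) < 1"
  shows "1 - (turning p q s)\<^sup>2 =
    (1 - (norm (exp s *\<^sub>R p + exp (- s) *\<^sub>R q))\<^sup>2) / (1 - 2 * (norm p * norm q + p \<bullet> q))"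
  using assms by (simp add: turning_def norm_exp_combination_sq power_divide field_simps)

lemma turning_bound:
  fixes p q :: "'a::real_inner"
  assumes "2 * (norm p * norm q + p \<bullet> q) < 1"
  shows "norm (exp s *\<^sub>R p + exp (- s) *\<^sub>R q) < 1 \<Longrightarrow> \<bar>turning p q s\<bar> < 1"
    and "norm (exp s *\<^sub>R p + exp (- s) *\<^sub>R q) \<le> 1 \<Longrightarrow> \<bar>turning p q s\<bar> \<le> 1"
proof -
  assume "norm (exp s *\<^sub>R p + exp (- s) *\<^sub>R q) < 1"
  then have "0 < 1 - (turning p q s)\<^sup>2"
    unfolding one_minus_turning_sq[OF assms] using assms by (simp add: abs_square_less_1)
  then show "\<bar>turning p q s\<bar> < 1" by (simp add: abs_square_less_1)
next
  assume "norm (exp s *\<^sub>R p + exp (- s) *\<^sub>R q) \<le> 1"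
  then have "0 \<le> 1 - (turning p q s)\<^sup>2"
    unfolding one_minus_turning_sq[OF assms] using assms by (simp add: abs_square_le_1)
  then show "\<bar>turning p q s\<bar> \<le> 1" by (simp add: abs_square_le_1)
qed

lemma turning_mono:
  "2 * (norm p * norm q + p \<bullet> q) < 1 \<Longrightarrow> s \<le> t \<Longrightarrow> turning p q s \<le> turning p q t"
  unfolding turning_def by (intro divide_right_mono diff_mono mult_left_mono) auto

lemma arcsin_turning_has_derivative:
  fixes p q :: "'a::real_inner"
  assumes "norm (exp s *\<^sub>R p + exp (- s) *\<^sub>R q) < 1" and k: "2 * (norm p * norm q + p \<bullet> q) < 1"
  shows "((\<lambda>s. arcsin (turning p q s)) has_real_derivative
    (norm p * exp s + norm q * exp (- s)) / sqrt (1 - (norm (exp s *\<^sub>R p + exp (- s) *\<^sub>R q))\<^sup>2)) (at s)"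
proof -
  define \<kappa> where "\<kappa> = sqrt (1 - 2 * (norm p * norm q + p \<bullet> q))"
  have \<kappa>: "\<kappa> > 0" "\<kappa>\<^sup>2 = 1 - 2 * (norm p * norm q + p \<bullet> q)" using k by (auto simp: \<kappa>_def)
  have S: "-1 < turning p q s" "turning p q s < 1"
    using turning_bound(1)[OF k assms(1)] by (auto simp: abs_less_iff)
  have "((\<lambda>s. turning p q s) has_real_derivative (norm p * exp s + norm q * exp (- s)) / \<kappa>) (at s)"
    unfolding turning_def \<kappa>_def[symmetric] using \<kappa>(1) by (auto intro!: derivative_eq_intros)
  from DERIV_chain2[where f = arcsin, OF DERIV_arcsin[OF S] this]
  have "((\<lambda>s. arcsin (turning p q s)) has_real_derivative
      inverse (sqrt (1 - (turning p q s)\<^sup>2)) * ((norm p * exp s + norm q * exp (- s)) / \<kappa>)) (at s)" .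
  moreover have "sqrt (1 - (turning p q s)\<^sup>2) =
      sqrt (1 - (norm (exp s *\<^sub>R p + exp (- s) *\<^sub>R q))\<^sup>2) / \<kappa>"
    unfolding one_minus_turning_sq[OF k] \<kappa>(2)[symmetric] using \<kappa>(1) by (simp add: real_sqrt_divide)
  ultimately show ?thesis using \<kappa>(1) by simp
qed

section \<open>Momentum in exponential form\<close>

text \<open>Along the momentum, \<open>lambda_snd\<close> and \<open>lambda_fst\<close> are each
  other's derivatives in \<open>s\<close>, so their half sum scales by \<open>exp s\<close> and
  their half difference by \<open>exp (- s)\<close>.\<close>

lemma lambda_snd_exp:
  assumes "geodesic_momentum lam"
  shows "lambda_snd (lam s) =
    exp s *\<^sub>R ((1/2) *\<^sub>R (lambda_snd (lam 0) + lambda_fst (lam 0))) +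
    exp (- s) *\<^sub>R ((1/2) *\<^sub>R (lambda_snd (lam 0) - lambda_fst (lam 0)))"
proof -
  have "lam s $ 4 = lam 0 $ 4 * cosh s + lam 0 $ 2 * sinh s"
    "lam s $ 5 = lam 0 $ 5 * cosh s - lam 0 $ 1 * sinh s"
    using assms unfolding geodesic_momentum_def by blast+
  then show ?thesis
    by (simp add: vec_eq_iff forall_2 lambda_snd_def lambda_fst_def cosh_field_def sinh_field_def
        field_simps)
qed

lemma norm_lambda_snd_sq: "(norm (lambda_snd l))\<^sup>2 = (l $ 4)\<^sup>2 + (l $ 5)\<^sup>2"
  unfolding power2_norm_eq_inner
  by (simp add: inner_vec_def sum_2 lambda_snd_def power2_eq_square)

lemma lambda3_eq:
  assumes "geodesic_momentum lam"
  shows "lam s $ 3 = sqrt (1 - (norm (lambda_snd (lam s)))\<^sup>2)"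
proof -
  have "lam s $ 3 = sqrt (1 - (lam s $ 4)\<^sup>2 - (lam s $ 5)\<^sup>2)"
    using assms unfolding geodesic_momentum_def by blast
  then show ?thesis by (simp add: norm_lambda_snd_sq diff_diff_eq)
qed

text \<open>The third column of the generator is \<open>lambda_snd\<close> padded with a
  zero.\<close>

lemma norm_rotation_generator_axis:
  "norm (rotation_generator l *v axis 3 1) = norm (lambda_snd l)"
  unfolding norm_eq_sqrt_inner
  by (simp add: inner_vec_def sum_3 sum_2 lambda_snd_def rotation_generator_def
      matrix_vector_mult_def axis_def)

section \<open>Lower bound for the derivative of z\<close>

text \<open>The left side is the cosine of a difference of arcsines, expanded; the right side is
  z'(s). At 0 the bound on \<open>turning\<close> is not strict because \<open>lam 0 $ 3\<close> may
  vanish.\<close>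

lemma z_derivative_lower_bound:
  assumes geo: "geodesic_from_identity lam \<gamma>" and cl: "cuspless lam"
    and s: "0 < s" "ereal s < s_max lam"
    and p: "p = (1/2) *\<^sub>R (lambda_snd (lam 0) + lambda_fst (lam 0))"
    and q: "q = (1/2) *\<^sub>R (lambda_snd (lam 0) - lambda_fst (lam 0))"
  shows "sqrt (1 - (turning p q s)\<^sup>2) * sqrt (1 - (turning p q 0)\<^sup>2) + turning p q s * turning p q 0
      \<le> snd (\<gamma> s) $ 3 $ 3" (is ?bound)
    and "\<bar>turning p q s\<bar> < 1" "\<bar>turning p q 0\<bar> \<le> 1" "2 * (norm p * norm q + p \<bullet> q) < 1"
proof -
  have mom: "geodesic_momentum lam" and \<gamma>0: "\<gamma> 0 = (0, mat 1)"
    and SE: "\<And>s. 0 \<le> s \<Longrightarrow> ereal s < s_max lam \<Longrightarrow> \<gamma> s \<in> SE3"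
    and \<gamma>_cont: "continuous_on {s. 0 \<le> s \<and> ereal s < s_max lam} \<gamma>"
    and R_deriv: "\<And>s. 0 < s \<Longrightarrow> ereal s < s_max lam \<Longrightarrow>
        ((\<lambda>t. snd (\<gamma> t)) has_vector_derivative
           ((1 / lam s $ 3) *\<^sub>R (snd (\<gamma> s) ** rotation_generator (lam s)))) (at s)"
    using geo unfolding geodesic_from_identity_def by blast+
  have V: "lambda_snd (lam t) = exp t *\<^sub>R p + exp (- t) *\<^sub>R q" for t
    unfolding p q using lambda_snd_exp[OF mom] .
  have dom: "ereal t < s_max lam" if "t \<le> s" for t
    using that s(2) le_less_trans[of "ereal t" "ereal s"] by simp
  have lam3: "lam t $ 3 = sqrt (1 - (norm (exp t *\<^sub>R p + exp (- t) *\<^sub>R q))\<^sup>2)" for t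
    using lambda3_eq[OF mom] V by simp
  have V1: "norm (exp t *\<^sub>R p + exp (- t) *\<^sub>R q) < 1" if "0 < t" "t \<le> s" for t
    using cl dom[OF that(2)] that(1) lam3[of t] unfolding cuspless_def
    by (fastforce simp: abs_square_less_1)
  have "(lam 0 $ 4)\<^sup>2 + (lam 0 $ 5)\<^sup>2 \<le> 1" using mom unfolding geodesic_momentum_def by blast
  then have "(norm (lambda_snd (lam 0)))\<^sup>2 \<le> 1" by (simp add: norm_lambda_snd_sq)
  then have V0: "norm (exp 0 *\<^sub>R p + exp (- 0) *\<^sub>R q) \<le> 1"
    using V[of 0] by (simp add: abs_square_le_1)
  \<comment> \<open>The constant in \<open>norm_exp_combination_sq\<close> is at most this squared
    norm.\<close>
  have "(norm (exp s *\<^sub>R p + exp (- s) *\<^sub>R q))\<^sup>2 < 1"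
    using V1[of s] s by (simp add: abs_square_less_1)
  then show k: "2 * (norm p * norm q + p \<bullet> q) < 1"
    unfolding norm_exp_combination_sq
    by (smt (verit) zero_le_power2)
  show S0: "\<bar>turning p q 0\<bar> \<le> 1" using turning_bound(2)[OF k V0] .
  have S1: "\<bar>turning p q t\<bar> < 1" if "0 < t" "t \<le> s" for t
    using turning_bound(1)[OF k V1[OF that]] .
  then show Ss: "\<bar>turning p q s\<bar> < 1" using s by simp
  have S: "\<bar>turning p q t\<bar> \<le> 1" if "0 \<le> t" "t \<le> s" for t
    using S0 S1[of t] that by (cases "t = 0") auto
  define T where "T t = snd (\<gamma> t) *v axis 3 1" for t
  define \<psi> where "\<psi> t = arcsin (turning p q t)" for t
  have orth: "norm (snd (\<gamma> t) *v x) = norm x" if "0 \<le> t" "t \<le> s" for t x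
  proof -
    have "orthogonal_matrix (snd (\<gamma> t))"
      using SE[OF that(1) dom[OF that(2)]] by (simp add: SE3_def case_prod_beta)
    then have "orthogonal_transformation ((*v) (snd (\<gamma> t)))"
      by (simp add: orthogonal_transformation_matrix)
    then show ?thesis by (rule orthogonal_transformation_norm)
  qed
  have blin: "bounded_linear (\<lambda>A::real^3^3. A *v axis 3 1)"
    by (simp add: linear_conv_bounded_linear[symmetric] linear_iff matrix_vector_mult_add_rdistrib
        scaleR_matrix_vector_assoc)
  have "cos (\<psi> s - \<psi> 0) \<le> T 0 \<bullet> T s"
  proof (rule cos_le_inner_unit_curve)
    have "continuous_on {0..s} \<gamma>"
      using \<gamma>_cont dom by (auto intro: continuous_on_subset)
    then show "continuous_on {0..s} T"
      unfolding T_def by (rule bounded_linear.continuous_on[OF blin continuous_on_snd])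
    show "continuous_on {0..s} \<psi>"
      unfolding \<psi>_def
    proof (rule continuous_on_arcsin)
      show "continuous_on {0..s} (turning p q)"
        unfolding turning_def using k by (intro continuous_intros) simp
      show "\<forall>t\<in>{0..s}. - 1 \<le> turning p q t \<and> turning p q t \<le> 1"
        using S by (fastforce simp: abs_le_iff)
    qed
    show "norm (T t) = 1" if "0 \<le> t" "t \<le> s" for t
      unfolding T_def using orth[OF that] by simp
    \<comment> \<open>For \<open>t > 0\<close> the value \<open>\<psi> t\<close> is strictly below
      \<open>pi / 2\<close>, which makes up for \<open>\<psi> 0\<close> possibly being
      \<open>- (pi / 2)\<close>.\<close>
    show "\<psi> t - \<psi> 0 < pi" if "0 \<le> t" "t \<le> s" for t
    proof (cases "t = 0")
      case False
      then have "\<psi> t < pi / 2"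
        using arcsin_less_arcsin[of "turning p q t" 1] S1[of t] that
        by (auto simp: \<psi>_def abs_less_iff)
      moreover have "- (pi / 2) \<le> \<psi> 0"
        using arcsin_lbound[of "turning p q 0"] S0 by (auto simp: \<psi>_def abs_le_iff)
      ultimately show ?thesis by linarith
    qed simp
    fix t assume t: "0 < t" "t < s"
    show "(T has_vector_derivative
        (1 / lam t $ 3) *\<^sub>R (snd (\<gamma> t) *v (rotation_generator (lam t) *v axis 3 1))) (at t)"
      unfolding T_def
      using bounded_linear.has_vector_derivative[OF blin R_deriv[of t]] t dom[of t]
      by (simp add: scaleR_matrix_vector_assoc[symmetric] matrix_vector_mul_assoc)
    show "(\<psi> has_real_derivative (norm p * exp t + norm q * exp (- t)) / lam t $ 3) (at t)"
      unfolding \<psi>_def lam3 using arcsin_turning_has_derivative[OF V1 k] t by simp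
    have pos: "lam t $ 3 > 0" using cl t dom[of t] unfolding cuspless_def by auto
    have "norm (exp t *\<^sub>R p + exp (- t) *\<^sub>R q) \<le> norm p * exp t + norm q * exp (- t)"
      by (rule order_trans[OF norm_triangle_ineq]) (simp add: mult.commute)
    then show "norm ((1 / lam t $ 3) *\<^sub>R (snd (\<gamma> t) *v (rotation_generator (lam t) *v axis 3 1)))
        \<le> (norm p * exp t + norm q * exp (- t)) / lam t $ 3"
      using pos t by (simp add: orth norm_rotation_generator_axis V divide_right_mono)
  qed (use s in simp)
  \<comment> \<open>The initial rotation is the identity, so \<open>T 0\<close> is the
    z-axis.\<close>
  moreover have "T 0 \<bullet> T s = snd (\<gamma> s) $ 3 $ 3"
    by (simp add: T_def \<gamma>0 inner_axis' matrix_vector_mul_component inner_axis)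
  ultimately show ?bound
    using S0 Ss by (simp add: \<psi>_def cos_diff cos_arcsin abs_le_iff abs_less_iff)
qed

section \<open>Comparison of \<open>s_m\<close> with \<open>s_max\<close>\<close>

text \<open>
  \<open>\<parallel>V\<parallel>\<^sup>2\<close> is strictly convex and takes equal values at \<open>0\<close> and at \<open>log (\<parallel>q\<parallel> / \<parallel>p\<parallel>)\<close>, so it stays
  below \<open>1\<close> in between; this is why \<open>s_m\<close> does not exceed \<open>s_max\<close>.
\<close>

lemma s_max_greater:
  assumes mom: "geodesic_momentum lam"
    and p: "p = (1/2) *\<^sub>R (lambda_snd (lam 0) + lambda_fst (lam 0))"
    and q: "q = (1/2) *\<^sub>R (lambda_snd (lam 0) - lambda_fst (lam 0))"
    and s: "norm p * exp s < norm q"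
  shows "ereal s < s_max lam"
proof -
  have lam3: "lam t $ 3 \<noteq> 0" if t: "0 < t" "norm p * exp t < norm q" for t
  proof -
    have "(lam 0 $ 4)\<^sup>2 + (lam 0 $ 5)\<^sup>2 \<le> 1" using mom unfolding geodesic_momentum_def by blast
    then have "(norm (exp 0 *\<^sub>R p + exp (- 0) *\<^sub>R q))\<^sup>2 \<le> 1"
      using lambda_snd_exp[OF mom, of 0] unfolding p q by (simp add: norm_lambda_snd_sq)
    then have "(norm p - norm q)\<^sup>2 + 2 * (norm p * norm q + p \<bullet> q) \<le> 1"
      unfolding norm_exp_combination_sq by simp
    moreover have "\<bar>norm p * exp t - norm q * exp (- t)\<bar> < \<bar>norm p - norm q\<bar>"
    proof -
      have e: "exp t > 1" "exp t * exp (- t) = 1" using t by (auto simp: exp_minus_inverse)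
      have a: "norm p < norm q * exp (- t)"
        using t(2) by (simp add: exp_minus field_simps)
      \<comment> \<open>Equivalently, \<open>norm p * exp t + norm q * exp (- t)\<close> is below
        \<open>norm p + norm q\<close>; this makes the estimate strict.\<close>
      have "norm q * exp (- t) - norm p < norm q - norm p * exp t"
      proof -
        have "norm q - norm p * exp t = exp t * (norm q * exp (- t) - norm p)"
          using e by (simp add: algebra_simps)
        then show ?thesis using a e(1) by simp
      qed
      moreover have "norm p \<le> norm p * exp t" using e(1) by (simp add: mult_le_cancel_left1)
      moreover have "norm q * exp (- t) \<le> norm q" using e(1) t by (simp add: mult_le_cancel_left2)
      ultimately show ?thesis using t(2) a by linarith
    qed
    then have "(norm p * exp t - norm q * exp (- t))\<^sup>2 < (norm p - norm q)\<^sup>2"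
      using abs_le_square_iff not_le by blast
    ultimately have "(norm (exp t *\<^sub>R p + exp (- t) *\<^sub>R q))\<^sup>2 < 1"
      unfolding norm_exp_combination_sq by linarith
    then show ?thesis
      using lambda3_eq[OF mom, of t] lambda_snd_exp[OF mom, of t] unfolding p q by simp
  qed
  \<comment> \<open>The infimum only yields \<open>\<le>\<close>, so the hypothesis is first pushed
    to some \<open>m > s\<close>.\<close>
  have "((\<lambda>t. norm p * exp t) \<longlongrightarrow> norm p * exp s) (at_right s)"
    by (intro tendsto_intros)
  from order_tendstoD(2)[OF this s]
  have "eventually (\<lambda>t. norm p * exp t < norm q) (at_right s)" .
  then obtain r where r: "r > s" "\<And>t. s < t \<Longrightarrow> t < r \<Longrightarrow> norm p * exp t < norm q"
    unfolding eventually_at_right_field by blast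
  define m where "m = (s + r) / 2"
  have m: "s < m" "norm p * exp m < norm q" using r by (auto simp: m_def field_simps)
  have "ereal m \<le> s_max lam" unfolding s_max_def
  proof (rule Inf_greatest, clarify)
    fix t assume t: "0 < t" "lam t $ 3 = 0"
    show "ereal m \<le> ereal t"
    proof (rule ccontr)
      assume "\<not> ereal m \<le> ereal t"
      then have "norm p * exp t \<le> norm p * exp m" by (intro mult_left_mono) auto
      then show False using lam3[of t] t m by linarith
    qed
  qed
  then show ?thesis using m(1) less_le_trans[of "ereal s" "ereal m"] by simp
qed

lemma exp_less_of_less_s_m:
  assumes "ereal s < s_m l"
    and neg: "lambda_fst l \<bullet> lambda_snd l < 0"
  shows "norm (lambda_snd l + lambda_fst l) * exp s < norm (lambda_snd l - lambda_fst l)"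
proof (cases "lambda_fst l = - lambda_snd l")
  case True
  \<comment> \<open>The growing part vanishes here, leaving
    \<open>0 < norm (2 *\<^sub>R lambda_snd l)\<close>.\<close>
  then have "lambda_snd l \<noteq> 0" using neg by auto
  moreover have "lambda_snd l - lambda_fst l = 2 *\<^sub>R lambda_snd l"
    using True by (simp add: scaleR_2)
  ultimately show ?thesis using True by simp
next
  case False
  then have P: "norm (lambda_snd l + lambda_fst l) > 0"
    by (metis add_eq_0_iff zero_less_norm_iff)
  have Q: "norm (lambda_snd l - lambda_fst l) > 0"
    using neg inner_ge_zero[of "lambda_snd l"] by (auto simp del: inner_ge_zero)
  have "s < ln (norm (lambda_snd l - lambda_fst l) / norm (lambda_snd l + lambda_fst l))"
    using assms(1) False P Q by (simp add: s_m_def log_quotient_def split: if_splits)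
  then have "exp s < norm (lambda_snd l - lambda_fst l) / norm (lambda_snd l + lambda_fst l)"
    using P Q by (metis divide_pos_pos exp_less_mono exp_ln)
  then show ?thesis using P by (simp add: field_simps)
qed

section \<open>Positivity of z by integration\<close>

theorem corollary6:
  fixes lam :: "real \<Rightarrow> real^6"
    and \<gamma> :: "real \<Rightarrow> (real^3) \<times> (real^3^3)"
  assumes "geodesic_from_identity lam \<gamma>"
    and "cuspless lam"
    and "(lam 0 $ 1)\<^sup>2 + (lam 0 $ 2)\<^sup>2 + (lam 0 $ 3)\<^sup>2 \<noteq> 0"
  shows "(lambda_fst (lam 0) \<bullet> lambda_snd (lam 0) \<ge> 0 \<longrightarrow>
            (\<forall>s. 0 < s \<and> ereal s < s_max lam \<longrightarrow> z_coord (\<gamma> s) > 0)) \<and>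
         (lambda_fst (lam 0) \<bullet> lambda_snd (lam 0) < 0 \<longrightarrow>
            (\<forall>s. 0 < s \<and> ereal s < s_m (lam 0) \<longrightarrow> z_coord (\<gamma> s) > 0))"
proof -
  define p where "p = (1/2) *\<^sub>R (lambda_snd (lam 0) + lambda_fst (lam 0))"
  define q where "q = (1/2) *\<^sub>R (lambda_snd (lam 0) - lambda_fst (lam 0))"
  note bound = z_derivative_lower_bound[OF assms(1,2) _ _ p_def q_def]
  have mom: "geodesic_momentum lam" and \<gamma>0: "\<gamma> 0 = (0, mat 1)"
    and \<gamma>_cont: "continuous_on {s. 0 \<le> s \<and> ereal s < s_max lam} \<gamma>"
    and x_deriv: "\<And>s. 0 < s \<Longrightarrow> ereal s < s_max lam \<Longrightarrow>
        ((\<lambda>t. fst (\<gamma> t)) has_vector_derivative (snd (\<gamma> s) *v axis 3 1)) (at s)"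
    using assms(1) unfolding geodesic_from_identity_def by blast+
  have z0: "z_coord (\<gamma> 0) = 0" by (simp add: z_coord_def \<gamma>0)
  have z_deriv: "((\<lambda>t. z_coord (\<gamma> t)) has_real_derivative snd (\<gamma> s) $ 3 $ 3) (at s)"
    if "0 < s" "ereal s < s_max lam" for s
    using bounded_linear.has_vector_derivative[OF bounded_linear_vec_nth x_deriv[OF that], of 3]
    unfolding z_coord_def has_real_derivative_iff_has_vector_derivative
    by (simp add: matrix_vector_mul_component inner_axis)
  have dom: "ereal t < s_max lam" if "ereal s < s_max lam" "t \<le> s" for s t
    using that le_less_trans[of "ereal t" "ereal s"] by simp
  have z_cont: "continuous_on {0..s} (\<lambda>t. z_coord (\<gamma> t))" if "ereal s < s_max lam" for s
  proof -
    have "continuous_on {0..s} \<gamma>"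
      using \<gamma>_cont dom[OF that] by (auto intro: continuous_on_subset)
    then show ?thesis unfolding z_coord_def by (intro continuous_intros)
  qed
  \<comment> \<open>Polarisation: the sign of the inner product decides which of
    \<open>norm p\<close> and \<open>norm q\<close> is larger, hence the sign of
    \<open>turning p q 0\<close>.\<close>
  have diff: "lambda_fst (lam 0) \<bullet> lambda_snd (lam 0) = (norm p)\<^sup>2 - (norm q)\<^sup>2"
    unfolding p_def q_def power2_norm_eq_inner
    by (simp add: algebra_simps inner_commute)
  show ?thesis
  proof (intro conjI impI allI; elim conjE)
    fix s :: real
    assume "0 \<le> lambda_fst (lam 0) \<bullet> lambda_snd (lam 0)" and s: "0 < s" "ereal s < s_max lam"
    then have pq: "norm q \<le> norm p" using diff by (simp add: power2_le_iff_abs_le)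
    have "z_coord (\<gamma> 0) < z_coord (\<gamma> s)"
    proof (rule DERIV_pos_imp_increasing_open[OF s(1) _ z_cont[OF s(2)]])
      fix t assume t: "0 < t" "t < s"
      have d: "ereal t < s_max lam" using dom[OF s(2)] t by auto
      note b = bound[OF t(1) d]
      have "0 \<le> turning p q 0" unfolding turning_def using pq b(4) by auto
      \<comment> \<open>Monotonicity makes \<open>turning p q 0 < 1\<close> strict, so both square
        roots below are positive.\<close>
      moreover have "turning p q 0 \<le> turning p q t" using turning_mono[OF b(4)] t by simp
      ultimately have S: "0 \<le> turning p q t" "0 \<le> turning p q 0" "turning p q 0 < 1"
        using b(2) by auto
      have "0 < sqrt (1 - (turning p q t)\<^sup>2) * sqrt (1 - (turning p q 0)\<^sup>2)"
        using S b(2) by (intro mult_pos_pos) (auto simp: abs_square_less_1)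
      moreover have "0 \<le> turning p q t * turning p q 0" using S by simp
      ultimately have "0 < snd (\<gamma> t) $ 3 $ 3" using b(1) by linarith
      then show "\<exists>y. ((\<lambda>t. z_coord (\<gamma> t)) has_real_derivative y) (at t) \<and> 0 < y"
        using z_deriv[OF t(1) d] by blast
    qed
    then show "0 < z_coord (\<gamma> s)" using z0 by simp
  next
    fix s :: real
    assume neg: "lambda_fst (lam 0) \<bullet> lambda_snd (lam 0) < 0"
      and s: "0 < s" "ereal s < s_m (lam 0)"
    have less: "norm p * exp s < norm q"
      using exp_less_of_less_s_m[OF s(2) neg] unfolding p_def q_def norm_scaleR by simp
    have d: "ereal s < s_max lam" using s_max_greater[OF mom p_def q_def less] .
    define \<kappa> where "\<kappa> = sqrt (1 - 2 * (norm p * norm q + p \<bullet> q))"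
    have \<kappa>: "\<kappa> > 0" using bound(4)[OF s(1) d] by (simp add: \<kappa>_def)
    have pq: "norm p < norm q"
      using diff neg by (simp add: power2_less_imp_less)
    have S0: "turning p q 0 < 0"
      unfolding turning_def \<kappa>_def[symmetric] using pq \<kappa> by (simp add: divide_neg_pos)
    \<comment> \<open>Integrating the numerator of \<open>turning\<close> flips its minus sign, so
      \<open>F\<close> is an antiderivative of the lower bound S(0) S(t).\<close>
    define F where "F t = turning p q 0 * ((norm p * exp t + norm q * exp (- t)) / \<kappa>)" for t
    have F_deriv: "(F has_real_derivative turning p q 0 * turning p q t) (at t)" for t
      unfolding F_def turning_def[of p q t] \<kappa>_def[symmetric]
      using \<kappa> by (auto intro!: derivative_eq_intros)
    have "z_coord (\<gamma> 0) - F 0 \<le> z_coord (\<gamma> s) - F s"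
    proof (rule DERIV_nonneg_imp_increasing_open[where f = "\<lambda>t. z_coord (\<gamma> t) - F t"])
      show "continuous_on {0..s} (\<lambda>t. z_coord (\<gamma> t) - F t)"
        using z_cont[OF d] \<kappa> by (auto simp: F_def intro!: continuous_intros)
      fix t assume t: "0 < t" "t < s"
      have dt: "ereal t < s_max lam" using dom[OF d] t by auto
      note b = bound[OF t(1) dt]
      \<comment> \<open>The product of roots is only nonnegative: it vanishes if
        \<open>turning p q 0 = - 1\<close>.\<close>
      have "0 \<le> sqrt (1 - (turning p q t)\<^sup>2) * sqrt (1 - (turning p q 0)\<^sup>2)"
        using b(2,3) by (intro mult_nonneg_nonneg) (auto simp: abs_square_le_1)
      then have "0 \<le> snd (\<gamma> t) $ 3 $ 3 - turning p q 0 * turning p q t"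
        using b(1) by (simp add: mult.commute)
      then show "\<exists>y. ((\<lambda>t. z_coord (\<gamma> t) - F t) has_real_derivative y) (at t) \<and> 0 \<le> y"
        using DERIV_diff[OF z_deriv[OF t(1) dt] F_deriv] by blast
    qed (use s in simp)
    moreover have "F 0 < F s"
    proof -
      have e: "exp s * exp (- s) = 1" "exp s > 1" using s by (auto simp: exp_minus_inverse)
      \<comment> \<open>For nonzero \<open>p\<close> the factors vanish at 0 and at log(|q| / |p|),
        which is where \<open>s_m\<close> comes from; \<open>turning p q 0 < 0\<close> then reverses
        the inequality.\<close>
      have "(norm p * exp s + norm q * exp (- s)) - (norm p + norm q)
          = (exp s - 1) * (norm p - norm q * exp (- s))"
        using e by (simp add: algebra_simps)
      also have "\<dots> < 0"
        using e(2) less by (intro mult_pos_neg) (auto simp: exp_minus field_simps)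
      finally have "(norm p * exp s + norm q * exp (- s)) / \<kappa> < (norm p + norm q) / \<kappa>"
        using \<kappa> by (simp add: divide_strict_right_mono)
      from mult_strict_left_mono_neg[OF this S0] show ?thesis unfolding F_def by simp
    qed
    ultimately show "0 < z_coord (\<gamma> s)" using z0 by simp
  qed
qed

end
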